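(* Let $d\geqslant 2$ be an integer, let $r\leqslant d-2$ be an integer with $\gcd(r,d)=1$, and let $n$ be a positive integer with $n\equiv -r\pmod d$ and $n\geqslant d-r$. Let $a,q$ be indeterminates. If $d$ is odd, then modulo $(1-aq^n)(a-q^n)$, \[ \sum_{k=0}^{n-1}\frac{(q^r;q^d)_k\, q^{dk}\prod_{j=1}^{(d-1)/2}(a^{2j}q^r;q^d)_k\,(a^{-2j}q^r;q^d)_k}{(q^d;q^d)_k\prod_{j=1}^{(d-1)/2}(a^{2j-1}q^d;q^d)_k\,(a^{1-2j}q^d;q^d)_k}\equiv 0 . \] If $d$ is even, then modulo $(1-aq^n)(a-q^n)$, \[ \sum_{k=0}^{n-1}\frac{q^{dk}\prod_{j=1}^{d/2}(a^{2j-1}q^r;q^d)_k\,(a^{1-2j}q^r;q^d)_k}{\prod_{j=0}^{d/2-1}(a^{2j}q^d;q^d)_k\,(a^{-2j}q^d;q^d)_k}\equiv 0 . \]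
   Context: $(x;q)_k=(1-x)(1-xq)\cdots(1-xq^{k-1})$ (with $(x;q)_0=1$) is the $q$-shifted factorial. The sums are rational functions in $a$ and $q$ whose denominators are coprime to $(1-aq^n)(a-q^n)$; the congruence to $0$ modulo $(1-aq^n)(a-q^n)$ means that the numerator is divisible by $(1-aq^n)(a-q^n)$ in the ring of Laurent polynomials in $a,q$ with rational coefficients (equivalently, the sum vanishes at $a=q^{n}$ and at $a=q^{-n}$). *)

theory Defs
  imports
    "HOL-Library.Poly_Mapping"
    "HOL-Computational_Algebra.Computational_Algebra"
    "HOL-Number_Theory.Cong"
begin

text \<open>
  The Laurent polynomial ring \<open>\<rat>[a, a\<^sup>-\<^sup>1, q, q\<^sup>-\<^sup>1]\<close>: finitely supported maps from exponents of \<open>a\<close>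
  to finitely supported maps from exponents of \<open>q\<close> to rational coefficients, with convolution
  product. Its fraction field is \<open>\<rat>(a, q)\<close>.
\<close>

type_synonym laurent = "int \<Rightarrow>\<^sub>0 (int \<Rightarrow>\<^sub>0 rat)"

definition laurent_a :: laurent
  where "laurent_a = Poly_Mapping.single 1 1"

definition laurent_q :: laurent
  where "laurent_q = Poly_Mapping.single 0 (Poly_Mapping.single 1 1)"

definition var_a :: "laurent fract"
  where "var_a = to_fract laurent_a"

definition var_q :: "laurent fract"
  where "var_q = to_fract laurent_q"

definition qpoch :: "'a::comm_ring_1 \<Rightarrow> 'a \<Rightarrow> nat \<Rightarrow> 'a"
  where "qpoch x q k = (\<Prod>i<k. 1 - x * q ^ i)"

text \<open>
  This is \<^const>\<open>coprime\<close> written out: that constant requires the class \<^class>\<open>algebraic_semidom\<close>,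
  of which \<^typ>\<open>laurent\<close> is not an instance.
\<close>

definition coprime_in :: "'a::comm_ring_1 \<Rightarrow> 'a \<Rightarrow> bool"
  where "coprime_in x y \<longleftrightarrow> (\<forall>c. c dvd x \<longrightarrow> c dvd y \<longrightarrow> c dvd 1)"

definition ratfun_cong_0 :: "'a::idom fract \<Rightarrow> 'a \<Rightarrow> bool"
  where "ratfun_cong_0 F P \<longleftrightarrow>
    (\<exists>N D. D \<noteq> 0 \<and> coprime_in D P \<and> F = to_fract N / to_fract D \<and> P dvd N)"

end

theory Submission
  imports Defs
begin

text \<open>
  The modulus is, up to a unit, \<open>(a - q\<^sup>n) (a - q\<^sup>-\<^sup>n)\<close>, so it suffices that the sum vanishes under
  \<open>a = q\<^sup>n\<close> and \<open>a = q\<^sup>-\<^sup>n\<close>; both give the same sum because the summand is invariant under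
  \<open>a \<mapsto> a\<^sup>-\<^sup>1\<close>. With \<open>a = q\<^sup>n\<close> the numerator parameter \<open>a\<^sup>1\<^sup>-\<^sup>d q\<^sup>r\<close> becomes \<open>q\<^sup>-\<^sup>d\<^sup>N\<close>, and each of the
  remaining \<open>d - 1\<close> numerator parameters is \<open>q\<^sup>d\<^sup>m\<close> times a denominator parameter. The resulting
  series is terminating of Karlsson--Minton type, and its sum is zero because \<open>(d - 1) m < N\<close>.
\<close>

section \<open>Terminating q-series of Karlsson-Minton type\<close>

lemma qpoch_Suc: "qpoch x q (Suc k) = qpoch x q k * (1 - x * q ^ k)"
  by (simp add: qpoch_def)

lemma qpoch_add: "qpoch x q (k + m) = qpoch x q k * qpoch (x * q ^ k) q m"
  by (induction m) (simp_all add: qpoch_Suc qpoch_def power_add mult.assoc)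

text \<open>Both sides are the product of the first \<open>k + m\<close> factors, split once after
  \<open>m\<close> and once after \<open>k\<close>. This exchange turns a quotient of length
  \<open>k\<close> into one of fixed length \<open>m\<close>.\<close>

lemma qpoch_shift_commute:
  "qpoch (x * q ^ m) q k * qpoch x q m = qpoch (x * q ^ k) q m * qpoch x q k"
  using qpoch_add[of x q k m] qpoch_add[of x q m k] by (simp add: add.commute mult.commute)

lemma qpoch_eq_0_iff:
  fixes x q :: "'a::idom"
  shows "qpoch x q k = 0 \<longleftrightarrow> (\<exists>i<k. x * q ^ i = 1)"
  by (auto simp: qpoch_def)

text \<open>
  With \<open>c k\<close> the coefficient of \<open>z ^ k\<close>, the polynomial \<open>G z = (\<Sum>k\<le>N. c k * z ^ k)\<close> satisfies
  \<open>(1 - z) * G z = (1 - z / q ^ N) * G (q * z)\<close>. Hence \<open>G (q ^ N) = 0\<close>, and the zero propagates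
  downwards to \<open>q ^ (N - 1), \<dots>, q\<close>.
\<close>

lemma terminating_q_binomial_eq_0:
  fixes q :: "'a::field"
  assumes q: "q \<noteq> 0" "\<And>i. i > 0 \<Longrightarrow> q ^ i \<noteq> 1" and j: "j \<ge> 1" "j \<le> N"
  shows "(\<Sum>k\<le>N. qpoch (inverse (q ^ N)) q k / qpoch q q k * q ^ (j * k)) = 0"
proof -
  define c where "c k = qpoch (inverse (q ^ N)) q k / qpoch q q k" for k
  define G where "G z = (\<Sum>k\<le>N. c k * z ^ k)" for z
  have nz: "1 - q ^ Suc k \<noteq> 0" for k using q(2)[of "Suc k"] by simp
  have c_Suc: "c (Suc k) * (1 - q ^ Suc k) = c k * (1 - inverse (q ^ N) * q ^ k)" for k
    using nz[of k] by (simp add: c_def qpoch_Suc)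
  \<comment> \<open>The recurrence stops at \<open>N\<close>: the coefficient following
    \<open>c N\<close> would be zero, so the shifted sum may be extended from \<open>k < N\<close>
    to \<open>k \<le> N\<close> below.\<close>
  have cN: "c N * (1 - inverse (q ^ N) * q ^ N) = 0"
    using q(1) by simp
  have step: "(1 - z) * G z = (1 - z * inverse (q ^ N)) * G (q * z)" for z
  proof -
    have "G z - G (q * z) = (\<Sum>k\<le>N. c k * (1 - q ^ k) * z ^ k)"
      by (simp add: G_def sum_subtractf[symmetric] algebra_simps power_mult_distrib)
    also have "\<dots> = (\<Sum>k<N. c (Suc k) * (1 - q ^ Suc k) * z ^ Suc k)"
      unfolding lessThan_Suc_atMost[symmetric] sum.lessThan_Suc_shift by simp
    also have "\<dots> = (\<Sum>k<N. c k * (1 - inverse (q ^ N) * q ^ k) * z ^ Suc k)"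
      by (simp only: c_Suc)
    also have "\<dots> = (\<Sum>k\<le>N. c k * (1 - inverse (q ^ N) * q ^ k) * z ^ Suc k)"
      unfolding lessThan_Suc_atMost[symmetric] sum.lessThan_Suc using cN by simp
    also have "\<dots> = z * (G z - inverse (q ^ N) * G (q * z))"
      by (simp add: G_def sum_subtractf[symmetric] sum_distrib_left algebra_simps
          power_mult_distrib)
    finally show ?thesis by (simp add: algebra_simps)
  qed
  have "j \<le> N \<Longrightarrow> j \<ge> 1 \<Longrightarrow> G (q ^ j) = 0" for j
  proof (induction j rule: inc_induct)
    case base
    then show ?case using step[of "q ^ N"] q by (simp)
  next
    case (step j)
    then show ?case using \<open>\<And>z. (1 - z) * G z = _ z\<close>[of "q ^ j"] q by simp
  qed
  then have "G (q ^ j) = 0" using j by blast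
  then show ?thesis by (simp add: G_def c_def power_mult)
qed

text \<open>
  Each quotient \<open>(b\<^sub>i q\<^sup>m; q)\<^sub>k / (b\<^sub>i; q)\<^sub>k\<close> equals \<open>(b\<^sub>i q\<^sup>k; q)\<^sub>m / (b\<^sub>i; q)\<^sub>m\<close>, a polynomial of
  degree at most \<open>m\<close> in \<open>q\<^sup>k\<close>.
\<close>

lemma karlsson_minton_sum_eq_0:
  fixes q :: "'a::field" and b :: "'i \<Rightarrow> 'a"
  assumes q: "q \<noteq> 0" "\<And>i. i > 0 \<Longrightarrow> q ^ i \<noteq> 1"
    and I: "finite I" "card I * m < N" and b: "\<And>i l. i \<in> I \<Longrightarrow> b i * q ^ l \<noteq> 1"
    and M: "N \<le> M"
  shows "(\<Sum>k\<le>M. qpoch (inverse (q ^ N)) q k * q ^ k * (\<Prod>i\<in>I. qpoch (b i * q ^ m) q k) /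
            (qpoch q q k * (\<Prod>i\<in>I. qpoch (b i) q k))) = 0"
proof -
  define c where "c k = qpoch (inverse (q ^ N)) q k / qpoch q q k" for k
  define P where "P = (\<Prod>i\<in>I. \<Prod>l<m. [:1, - (b i * q ^ l):])"
  define B where "B = (\<Prod>i\<in>I. qpoch (b i) q m)"
  have b_nz: "qpoch (b i) q k \<noteq> 0" if "i \<in> I" for i k
    using b[OF that] by (simp add: qpoch_eq_0_iff)
  have B: "B \<noteq> 0" using I b_nz by (simp add: B_def)
  have "degree P \<le> (\<Sum>i\<in>I. degree (\<Prod>l<m. [:1, - (b i * q ^ l):]))"
    unfolding P_def using degree_prod_sum_le[OF I(1)] by (simp add: o_def)
  also have "\<dots> \<le> (\<Sum>i\<in>I. m)"
  proof (rule sum_mono)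
    fix i
    have "degree (\<Prod>l<m. [:1, - (b i * q ^ l):]) \<le> (\<Sum>l<m. degree [:1, - (b i * q ^ l):])"
      using degree_prod_sum_le[of "{..<m}" "\<lambda>l. [:1, - (b i * q ^ l):]"] by (simp add: o_def)
    also have "\<dots> \<le> (\<Sum>l<m. 1)" by (intro sum_mono) simp
    finally show "degree (\<Prod>l<m. [:1, - (b i * q ^ l):]) \<le> m" by simp
  qed
  finally have deg: "degree P < N" using I(2) by simp
  have poly_P: "poly P (q ^ k) = (\<Prod>i\<in>I. qpoch (b i * q ^ k) q m)" for k
    by (simp add: P_def poly_prod qpoch_def mult_ac)
  have quot: "(\<Prod>i\<in>I. qpoch (b i * q ^ m) q k) / (\<Prod>i\<in>I. qpoch (b i) q k) = poly P (q ^ k) / B"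
    for k
    using b_nz unfolding poly_P B_def prod_dividef[symmetric]
    by (intro prod.cong refl) (simp add: divide_simps qpoch_shift_commute)
  have "(\<Sum>k\<le>M. qpoch (inverse (q ^ N)) q k * q ^ k * (\<Prod>i\<in>I. qpoch (b i * q ^ m) q k) /
            (qpoch q q k * (\<Prod>i\<in>I. qpoch (b i) q k)))
      = (\<Sum>k\<le>M. c k * q ^ k * ((\<Prod>i\<in>I. qpoch (b i * q ^ m) q k) / (\<Prod>i\<in>I. qpoch (b i) q k)))"
    by (simp add: c_def)
  also have "\<dots> = (\<Sum>k\<le>M. c k * q ^ k * (poly P (q ^ k) / B))"
    by (simp only: quot)
  \<comment> \<open>For \<open>k > N\<close> the factor of index \<open>N\<close> in
    \<open>qpoch (inverse (q ^ N)) q k\<close> is zero, so the series terminates at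
    \<open>N\<close>.\<close>
  also have "\<dots> = (\<Sum>k\<le>N. c k * q ^ k * (poly P (q ^ k) / B))"
  proof (rule sum.mono_neutral_right)
    show "\<forall>k\<in>{..M} - {..N}. c k * q ^ k * (poly P (q ^ k) / B) = 0"
      using q(1) by (auto simp: c_def qpoch_eq_0_iff intro!: exI[of _ N])
  qed (use M in auto)
  \<comment> \<open>Expanding \<open>P\<close> by coefficients, the extra \<open>q ^ k\<close> in
    the summand raises the exponent from \<open>j * k\<close> to \<open>Suc j * k\<close>. Since
    \<open>degree P < N\<close>, the number \<open>Suc j\<close> lies between 1 and
    \<open>N\<close>, the range of the q-binomial identity.\<close>
  also have "\<dots> = (\<Sum>k\<le>N. \<Sum>j\<le>degree P. coeff P j / B * (c k * q ^ (Suc j * k)))"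
    by (simp add: poly_altdef sum_distrib_left sum_divide_distrib power_add power_mult[symmetric]
        mult_ac)
  also have "\<dots> = (\<Sum>j\<le>degree P. coeff P j / B * (\<Sum>k\<le>N. c k * q ^ (Suc j * k)))"
    by (subst sum.swap) (simp add: sum_distrib_left)
  also have "\<dots> = 0"
    unfolding c_def
  proof (intro sum.neutral ballI)
    fix j assume "j \<in> {..degree P}"
    then have "(\<Sum>k\<le>N. qpoch (inverse (q ^ N)) q k / qpoch q q k * q ^ (Suc j * k)) = 0"
      using deg by (intro terminating_q_binomial_eq_0[OF q]) auto
    then show "coeff P j / B *
        (\<Sum>k\<le>N. qpoch (inverse (q ^ N)) q k / qpoch q q k * q ^ (Suc j * k)) = 0"
      by (simp only: mult_zero_right)
  qed
  finally show ?thesis .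
qed

section \<open>The series after \<open>a\<close> has become a power of \<open>q\<close>\<close>

text \<open>If the sum were zero, \<open>d\<close> would divide \<open>n * c\<close>, hence
  \<open>c\<close>, and the bound on \<open>c\<close> would force \<open>c = 0\<close>, leaving a
  positive number. The expression is the exponent of \<open>x\<close> in the \<open>l\<close>-th
  factor of a denominator.\<close>

lemma exponent_neq_0:
  fixes c n :: int and d l :: nat
  assumes "d > 0" "coprime n (int d)" "\<bar>c\<bar> < int d"
  shows "n * c + int d + int d * int l \<noteq> 0"
proof
  assume eq: "n * c + int d + int d * int l = 0"
  then have "n * c = int d * (- 1 - int l)" by (simp add: algebra_simps)
  then have "int d dvd n * c" by (rule dvdI)
  then have "int d dvd c"
    using assms(2) coprime_dvd_mult_right_iff[of "int d" n c] by (simp only: coprime_commute)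
  with assms(3) have "c = 0" using zdvd_not_zless[of "\<bar>c\<bar>" "int d"] by auto
  with eq have "int d * (1 + int l) = 0" by (simp add: distrib_left)
  then show False using assms(1) by simp
qed

lemma qpoch_denominator_neq_0:
  fixes x :: "'a::field" and c s n :: int and d :: nat
  assumes x: "x \<noteq> 0" "\<And>i. i \<noteq> 0 \<Longrightarrow> x powi i \<noteq> 1"
    and d: "d > 0" "coprime n (int d)" "\<bar>c\<bar> < int d" and s: "s = n \<or> s = - n"
  shows "qpoch (x powi (s * c + int d)) (x ^ d) k \<noteq> 0"
proof -
  have "x powi (s * c + int d) * (x ^ d) ^ l \<noteq> 1" for l
  proof -
    have "coprime s (int d)" using s d(2) by auto
    from x(2)[OF exponent_neq_0[OF d(1) this d(3)], of l] show ?thesis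
      using x(1) by (simp add: power_int_add power_int_mult)
  qed
  then show ?thesis by (simp add: qpoch_eq_0_iff)
qed

text \<open>
  This is the preceding identity in base \<open>x\<^sup>d\<close> with \<open>N = ((d - 1) * n - r) / d\<close> and
  \<open>m = (n + r - d) / d\<close>, for which \<open>N - (d - 1) * m = d - 1 - r \<ge> 1\<close>.
\<close>

lemma paired_sum_eq_0:
  fixes x :: "'a::field" and d n :: nat and r :: int and c :: "'i \<Rightarrow> int"
  assumes x: "x \<noteq> 0" "\<And>i. i \<noteq> 0 \<Longrightarrow> x powi i \<noteq> 1"
    and d: "d \<ge> 2" "r \<le> int d - 2"
    and n: "[int n = - r] (mod int d)" "int n \<ge> int d - r" "coprime (int n) (int d)"
    and I: "finite I" "card I = d - 1"
    and c: "\<And>i. i \<in> I \<Longrightarrow> \<bar>c i - 1\<bar> < int d"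
  shows "(\<Sum>k=0..n - 1. qpoch (x powi (int n * (1 - int d) + r)) (x ^ d) k * x ^ (d * k) *
            (\<Prod>i\<in>I. qpoch (x powi (int n * c i + r)) (x ^ d) k) /
            (qpoch (x ^ d) (x ^ d) k *
              (\<Prod>i\<in>I. qpoch (x powi (int n * (c i - 1) + int d)) (x ^ d) k))) = 0"
proof -
  have "int d dvd int n + r" using n(1) by (simp add: cong_iff_dvd_diff)
  \<comment> \<open>Here \<open>u = (n + r) / d\<close>, and \<open>n \<ge> d - r\<close> makes it
    at least 1. In terms of \<open>u\<close> the two parameters are \<open>m = u - 1\<close> and
    \<open>N = n - u\<close>.\<close>
  then obtain u where u: "int n + r = int d * u" by auto
  have "int d * 1 \<le> int d * u" using u n(2) by linarith
  then have u1: "u \<ge> 1" using d(1) by (subst (asm) mult_le_cancel_left_pos) auto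
  define m where "m = nat (u - 1)"
  define N where "N = nat (int n - u)"
  have nu: "- (int d * (int n - u)) = int n * (1 - int d) + r" using u by (simp add: algebra_simps)
  \<comment> \<open>The difference of the two sides is \<open>d - 1 - r\<close>, positive because
    \<open>r \<le> d - 2\<close>. This becomes the condition \<open>card I * m < N\<close>.\<close>
  have lt: "(int d - 1) * (u - 1) < int n - u"
  proof -
    have "int d * (u - 1) - (u - 1) < int n - u" using u d(2) by (simp add: algebra_simps)
    then show ?thesis by (simp add: algebra_simps)
  qed
  moreover have "0 \<le> (int d - 1) * (u - 1)" using d u1 by simp
  ultimately have Npos: "int n - u > 0" by linarith
  have mN: "int m = u - 1" "int N = int n - u" using u1 Npos by (auto simp: m_def N_def)
  have "int (card I * m) < int N" using lt d mN I(2) by (simp add: of_nat_diff)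
  then have cardI: "card I * m < N" by linarith
  \<comment> \<open>The range up to \<open>n - 1\<close> therefore contains every nonzero term of
    the terminating series.\<close>
  have NM: "N \<le> n - 1" using mN u1 by linarith
  have pw: "(x ^ d) ^ i = x powi (int d * int i)" for i
    by (simp add: power_mult[symmetric] power_int_def nat_mult_distrib)
  have b: "x powi (int n * (c i - 1) + int d) * (x ^ d) ^ m = x powi (int n * c i + r)" for i
  proof -
    have "int n * (c i - 1) + int d + int d * int m = int n * c i + r"
      unfolding mN using u by (simp add: algebra_simps)
    then show ?thesis using x(1) by (simp add: pw power_int_add[symmetric])
  qed
  have N_inv: "inverse ((x ^ d) ^ N) = x powi (int n * (1 - int d) + r)"
    using nu mN by (simp add: pw power_int_minus[symmetric])
  have "(\<Sum>k\<le>n - 1. qpoch (inverse ((x ^ d) ^ N)) (x ^ d) k * (x ^ d) ^ k *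
            (\<Prod>i\<in>I. qpoch (x powi (int n * (c i - 1) + int d) * (x ^ d) ^ m) (x ^ d) k) /
            (qpoch (x ^ d) (x ^ d) k *
              (\<Prod>i\<in>I. qpoch (x powi (int n * (c i - 1) + int d)) (x ^ d) k))) = 0"
  proof (rule karlsson_minton_sum_eq_0[OF _ _ I(1) cardI _ NM])
    show "(x ^ d) ^ i \<noteq> 1" if "i > 0" for i using x(2)[of "int d * int i"] d that by (simp add: pw)
    show "x powi (int n * (c i - 1) + int d) * (x ^ d) ^ l \<noteq> 1" if "i \<in> I" for i l
      using x(2)[OF exponent_neq_0[OF _ n(3) c[OF that], of l]] d(1) x(1) by (simp add: pw power_int_add[symmetric])
  qed (use x in simp)
  then show ?thesis by (simp add: b N_inv power_mult atLeast0AtMost)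
qed

section \<open>Regrouping the paired products\<close>

text \<open>Each induction step adds the two endpoints of the interval. Pairs indexed by
  \<open>j\<close> thus become one family indexed by \<open>t\<close>, in which numerators can be
  matched with denominators.\<close>

lemma prod_even_symmetric:
  fixes f :: "int \<Rightarrow> 'a::comm_monoid_mult"
  shows "f 0 * (\<Prod>j=1..m. f (2 * int j) * f (- 2 * int j)) = (\<Prod>t\<in>{- int m..int m}. f (2 * t))"
proof (induction m)
  case (Suc m)
  have "f 0 * (\<Prod>j=1..Suc m. f (2 * int j) * f (- 2 * int j)) =
      (f 0 * (\<Prod>j=1..m. f (2 * int j) * f (- 2 * int j))) *
      (f (2 * int (Suc m)) * f (2 * - int (Suc m)))"
    by (simp add: mult_ac)
  also have "\<dots> = (\<Prod>t\<in>{- int m..int m}. f (2 * t)) *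
      (f (2 * int (Suc m)) * f (2 * - int (Suc m)))"
    by (simp only: Suc.IH)
  also have "\<dots> = (\<Prod>t\<in>insert (- int (Suc m)) (insert (int (Suc m)) {- int m..int m}). f (2 * t))"
    by (simp add: mult_ac)
  also have "insert (- int (Suc m)) (insert (int (Suc m)) {- int m..int m})
      = {- int (Suc m)..int (Suc m)}"
    by auto
  finally show ?case .
qed simp

lemma prod_odd_symmetric:
  fixes f :: "int \<Rightarrow> 'a::comm_monoid_mult"
  shows "(\<Prod>j=1..m. f (2 * int j - 1) * f (1 - 2 * int j)) = (\<Prod>t\<in>{1 - int m..int m}. f (2 * t - 1))"
proof (induction m)
  case (Suc m)
  have "(\<Prod>j=1..Suc m. f (2 * int j - 1) * f (1 - 2 * int j)) =
      (\<Prod>j=1..m. f (2 * int j - 1) * f (1 - 2 * int j)) *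
      (f (2 * int (Suc m) - 1) * f (1 - 2 * int (Suc m)))"
    by (simp add: mult_ac)
  also have "1 - 2 * int (Suc m) = 2 * - int m - (1::int)" by simp
  also have "(\<Prod>j=1..m. f (2 * int j - 1) * f (1 - 2 * int j)) *
      (f (2 * int (Suc m) - 1) * f (2 * - int m - 1)) =
      (\<Prod>t\<in>{1 - int m..int m}. f (2 * t - 1)) *
      (f (2 * int (Suc m) - 1) * f (2 * - int m - 1))"
    by (simp only: Suc.IH)
  also have "\<dots> = (\<Prod>t\<in>insert (- int m) (insert (int (Suc m)) {1 - int m..int m}). f (2 * t - 1))"
    by (simp add: mult_ac)
  also have "insert (- int m) (insert (int (Suc m)) {1 - int m..int m})
      = {1 - int (Suc m)..int (Suc m)}"
    by auto
  finally show ?case .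
qed simp

text \<open>Changing the sign of \<open>s\<close> only swaps the two factors of each pair; this is
  the invariance under inverting \<open>a\<close>.\<close>

lemma prod_even_sign_symmetric:
  fixes h :: "int \<Rightarrow> 'a::comm_monoid_mult"
  assumes "s = n \<or> s = - n"
  shows "h 0 * (\<Prod>j=1..m. h (s * (2 * int j)) * h (s * (- 2 * int j))) =
    (\<Prod>t\<in>{- int m..int m}. h (n * (2 * t)))"
proof -
  have "h (s * (2 * int j)) * h (s * (- 2 * int j)) = h (n * (2 * int j)) * h (n * (- 2 * int j))" for j
    using assms by (auto simp: mult.commute)
  then show ?thesis using prod_even_symmetric[of "\<lambda>c. h (n * c)" m] by (simp only: mult_zero_right)
qed

lemma prod_odd_sign_symmetric:
  fixes h :: "int \<Rightarrow> 'a::comm_monoid_mult"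
  assumes "s = n \<or> s = - n"
  shows "(\<Prod>j=1..m. h (s * (2 * int j - 1)) * h (s * (1 - 2 * int j))) =
    (\<Prod>t\<in>{1 - int m..int m}. h (n * (2 * t - 1)))"
proof -
  have "h (- n * (2 * int j - 1)) * h (- n * (1 - 2 * int j)) =
      h (n * (2 * int j - 1)) * h (n * (1 - 2 * int j))" for j
  proof -
    have "- n * (2 * int j - 1) = n * (1 - 2 * int j)" "- n * (1 - 2 * int j) = n * (2 * int j - 1)"
      by (simp_all add: algebra_simps)
    then show ?thesis by (simp only: mult.commute)
  qed
  then have "h (s * (2 * int j - 1)) * h (s * (1 - 2 * int j)) =
      h (n * (2 * int j - 1)) * h (n * (1 - 2 * int j))" for j
    using assms by blast
  then show ?thesis using prod_odd_symmetric[of "\<lambda>c. h (n * c)" m] by (simp only:)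
qed

text \<open>The lone numerator with parameter \<open>x powi r\<close> is the member of exponent 0 in
  the family of \<open>a\<close>-exponents 1 - d, 3 - d, ..., d - 1. The exponent 1 - d supplies the
  terminating factor; each remaining exponent \<open>2 * t\<close> is matched with the denominator
  exponent \<open>2 * t - 1\<close>, as \<open>paired_sum_eq_0\<close> requires.\<close>

lemma odd_sum_eq_0:
  fixes x :: "'a::field" and d n :: nat and r s :: int
  assumes x: "x \<noteq> 0" "\<And>i. i \<noteq> 0 \<Longrightarrow> x powi i \<noteq> 1"
    and d: "d \<ge> 2" "r \<le> int d - 2" "odd d"
    and n: "[int n = - r] (mod int d)" "int n \<ge> int d - r" "coprime (int n) (int d)"
    and s: "s = int n \<or> s = - int n"
  shows "(\<Sum>k = 0..n - 1.
          (qpoch (x powi r) (x ^ d) k * x ^ (d * k) *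
            (\<Prod>j = 1..(d - 1) div 2.
              qpoch (x powi (s * (2 * int j) + r)) (x ^ d) k *
              qpoch (x powi (s * (- 2 * int j) + r)) (x ^ d) k)) /
          (qpoch (x ^ d) (x ^ d) k *
            (\<Prod>j = 1..(d - 1) div 2.
              qpoch (x powi (s * (2 * int j - 1) + int d)) (x ^ d) k *
              qpoch (x powi (s * (1 - 2 * int j) + int d)) (x ^ d) k))) = 0"
proof -
  obtain m where m: "d = 2 * m + 1" using d(3) by (elim oddE)
  define R where "R e k = qpoch (x powi e) (x ^ d) k" for e k
  let ?I = "{1 - int m..int m}"
  have num: "R r k * (\<Prod>j=1..m. R (s * (2 * int j) + r) k * R (s * (- 2 * int j) + r) k)
      = R (int n * (1 - int d) + r) k * (\<Prod>t\<in>?I. R (int n * (2 * t) + r) k)" for k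
  proof -
    have "R r k * (\<Prod>j=1..m. R (s * (2 * int j) + r) k * R (s * (- 2 * int j) + r) k)
        = (\<Prod>t\<in>{- int m..int m}. R (int n * (2 * t) + r) k)"
      using prod_even_sign_symmetric[OF s, of "\<lambda>e. R (e + r) k" m] by (simp only: add_0)
    \<comment> \<open>The index \<open>t = - m\<close> is split off because
      \<open>2 * (- m) = 1 - d\<close>.\<close>
    also have "{- int m..int m} = insert (- int m) ?I" by auto
    finally show ?thesis by (simp add: m)
  qed
  have den: "(\<Prod>j=1..m. R (s * (2 * int j - 1) + int d) k * R (s * (1 - 2 * int j) + int d) k)
      = (\<Prod>t\<in>?I. R (int n * (2 * t - 1) + int d) k)" for k
    by (rule prod_odd_sign_symmetric[OF s, of "\<lambda>e. R (e + int d) k" m])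
  \<comment> \<open>Moving the power of \<open>x\<close> to the end makes the two factors of
    \<open>num\<close> adjacent, so that \<open>num\<close> can rewrite them.\<close>
  have swap: "u * x ^ k * v = u * v * x ^ k" for u v k
    by (simp only: mult_ac)
  have "(\<Sum>k = 0..n - 1. R (int n * (1 - int d) + r) k * x ^ (d * k) *
            (\<Prod>t\<in>?I. R (int n * (2 * t) + r) k) /
            (qpoch (x ^ d) (x ^ d) k * (\<Prod>t\<in>?I. R (int n * (2 * t - 1) + int d) k))) = 0"
    unfolding R_def by (rule paired_sum_eq_0[OF x d(1,2) n]) (auto simp: m)
  moreover have "(\<Sum>k = 0..n - 1. R (int n * (1 - int d) + r) k * x ^ (d * k) *
            (\<Prod>t\<in>?I. R (int n * (2 * t) + r) k) /
            (qpoch (x ^ d) (x ^ d) k * (\<Prod>t\<in>?I. R (int n * (2 * t - 1) + int d) k))) =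
      (\<Sum>k = 0..n - 1. R r k * x ^ (d * k) *
            (\<Prod>j=1..m. R (s * (2 * int j) + r) k * R (s * (- 2 * int j) + r) k) /
            (qpoch (x ^ d) (x ^ d) k *
            (\<Prod>j=1..m. R (s * (2 * int j - 1) + int d) k * R (s * (1 - 2 * int j) + int d) k)))"
    unfolding den swap num ..
  ultimately show ?thesis by (simp add: R_def m)
qed

text \<open>The denominator pair at \<open>j = 0\<close> consists of two copies of
  \<open>qpoch (x ^ d) (x ^ d) k\<close>. One is the standing factor of
  \<open>paired_sum_eq_0\<close>, the other is matched with the numerator of
  \<open>a\<close>-exponent 1. The numerator of exponent 1 - d again terminates the series.\<close>

lemma even_sum_eq_0:
  fixes x :: "'a::field" and d n :: nat and r s :: int
  assumes x: "x \<noteq> 0" "\<And>i. i \<noteq> 0 \<Longrightarrow> x powi i \<noteq> 1"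
    and d: "d \<ge> 2" "r \<le> int d - 2" "even d"
    and n: "[int n = - r] (mod int d)" "int n \<ge> int d - r" "coprime (int n) (int d)"
    and s: "s = int n \<or> s = - int n"
  shows "(\<Sum>k = 0..n - 1.
          (x ^ (d * k) *
            (\<Prod>j = 1..d div 2.
              qpoch (x powi (s * (2 * int j - 1) + r)) (x ^ d) k *
              qpoch (x powi (s * (1 - 2 * int j) + r)) (x ^ d) k)) /
          (\<Prod>j = 0..d div 2 - 1.
              qpoch (x powi (s * (2 * int j) + int d)) (x ^ d) k *
              qpoch (x powi (s * (- 2 * int j) + int d)) (x ^ d) k)) = 0"
proof -
  obtain m' where m': "d = 2 * m'" using d(3) by (elim evenE)
  define m where "m = m' - 1"
  have m: "d = 2 * Suc m" using m' d(1) by (simp add: m_def)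
  define R where "R e k = qpoch (x powi e) (x ^ d) k" for e k
  let ?I = "{1 - int m..int m + 1}"
  have num: "(\<Prod>j=1..Suc m. R (s * (2 * int j - 1) + r) k * R (s * (1 - 2 * int j) + r) k)
      = R (int n * (1 - int d) + r) k * (\<Prod>t\<in>?I. R (int n * (2 * t - 1) + r) k)" for k
  proof -
    have "(\<Prod>j=1..Suc m. R (s * (2 * int j - 1) + r) k * R (s * (1 - 2 * int j) + r) k)
        = (\<Prod>t\<in>{1 - int (Suc m)..int (Suc m)}. R (int n * (2 * t - 1) + r) k)"
      by (rule prod_odd_sign_symmetric[OF s, of "\<lambda>e. R (e + r) k" "Suc m"])
    also have "{1 - int (Suc m)..int (Suc m)} = insert (- int m) ?I" by auto
    also have "(\<Prod>t\<in>insert (- int m) ?I. R (int n * (2 * t - 1) + r) k) =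
        R (int n * (2 * - int m - 1) + r) k * (\<Prod>t\<in>?I. R (int n * (2 * t - 1) + r) k)"
      by simp
    also have "2 * - int m - 1 = 1 - int d" by (simp add: m)
    finally show ?thesis .
  qed
  have den: "(\<Prod>j=0..m. R (s * (2 * int j) + int d) k * R (s * (- 2 * int j) + int d) k)
      = R (int d) k * (\<Prod>t\<in>?I. R (int n * (2 * t - 1 - 1) + int d) k)" for k
  proof -
    have "(\<Prod>j=0..m. R (s * (2 * int j) + int d) k * R (s * (- 2 * int j) + int d) k)
        = R (int d) k * (R (int d) k * (\<Prod>j=1..m. R (s * (2 * int j) + int d) k * R (s * (- 2 * int j) + int d) k))"
      by (simp add: prod.atLeast_Suc_atMost mult.assoc)
    also have "\<dots> = R (int d) k * (\<Prod>t\<in>{- int m..int m}. R (int n * (2 * t) + int d) k)"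
      using prod_even_sign_symmetric[OF s, of "\<lambda>e. R (e + int d) k" m] by (simp only: add_0)
    \<comment> \<open>Shifting \<open>t\<close> by one places the denominator exponent
      \<open>2 * t - 2\<close> opposite the numerator exponent \<open>2 * t - 1\<close>.\<close>
    also have "(\<Prod>t\<in>{- int m..int m}. R (int n * (2 * t) + int d) k) =
        (\<Prod>t\<in>?I. R (int n * (2 * t - 1 - 1) + int d) k)"
      by (rule prod.reindex_bij_witness[of _ "\<lambda>t. t - 1" "\<lambda>t. t + 1"]) auto
    finally show ?thesis .
  qed
  have swap: "u * x ^ k * v = u * v * x ^ k" for u v k
    by (simp only: mult_ac)
  have "(\<Sum>k = 0..n - 1. R (int n * (1 - int d) + r) k * x ^ (d * k) *
            (\<Prod>t\<in>?I. R (int n * (2 * t - 1) + r) k) /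
            (qpoch (x ^ d) (x ^ d) k * (\<Prod>t\<in>?I. R (int n * (2 * t - 1 - 1) + int d) k))) = 0"
    unfolding R_def by (rule paired_sum_eq_0[OF x d(1,2) n]) (auto simp: m)
  moreover have "(\<Sum>k = 0..n - 1. R (int n * (1 - int d) + r) k * x ^ (d * k) *
            (\<Prod>t\<in>?I. R (int n * (2 * t - 1) + r) k) /
            (qpoch (x ^ d) (x ^ d) k * (\<Prod>t\<in>?I. R (int n * (2 * t - 1 - 1) + int d) k))) =
      (\<Sum>k = 0..n - 1. x ^ (d * k) *
            (\<Prod>j=1..Suc m. R (s * (2 * int j - 1) + r) k * R (s * (1 - 2 * int j) + r) k) /
            (\<Prod>j=0..m. R (s * (2 * int j) + int d) k * R (s * (- 2 * int j) + int d) k))"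
    unfolding den swap num by (simp add: R_def mult.commute)
  ultimately show ?thesis by (simp add: R_def m del: prod.cl_ivl_Suc)
qed

section \<open>Substituting a power of \<open>q\<close> for \<open>a\<close>, and divisibility by
  linear factors\<close>

text \<open>The ring homomorphism that fixes \<open>q\<close> and sends \<open>a\<close> to q^s,
  with values in the Laurent polynomials in \<open>q\<close> alone. Allowing negative
  \<open>s\<close> covers both roots of the modulus.\<close>

definition subst_a :: "int \<Rightarrow> laurent \<Rightarrow> int \<Rightarrow>\<^sub>0 rat"
  where "subst_a s f = (\<Sum>i\<in>Poly_Mapping.keys f. Poly_Mapping.lookup f i * Poly_Mapping.single (s * i) 1)"

lemma subst_a_add: "subst_a s (f + g) = subst_a s f + subst_a s g"
  unfolding subst_a_def by (rule setsum_keys_plus_distrib) (simp_all add: distrib_right)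

lemma subst_a_0 [simp]: "subst_a s 0 = 0"
  by (simp add: subst_a_def)

lemma subst_a_single: "subst_a s (Poly_Mapping.single i c) = c * Poly_Mapping.single (s * i) 1"
  by (cases "c = 0") (simp_all add: subst_a_def)

lemma subst_a_1 [simp]: "subst_a s 1 = 1"
  using subst_a_single[of s 0 1] by simp

text \<open>A finitely supported map is the sum of its \<open>single\<close> terms over its support.
  Additive claims about \<open>subst_a\<close> thereby reduce to monomials in
  \<open>a\<close>.\<close>

lemma poly_mapping_single_add_induct [case_names zero single_add]:
  assumes "P 0" and "\<And>i c f. P f \<Longrightarrow> P (Poly_Mapping.single i c + f)"
  shows "P (f :: 'a \<Rightarrow>\<^sub>0 'b::comm_monoid_add)"
proof -
  have eq: "f = (\<Sum>i\<in>Poly_Mapping.keys f. Poly_Mapping.single i (Poly_Mapping.lookup f i))"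
    by (rule poly_mapping_eqI)
      (auto simp: lookup_sum lookup_single when_def in_keys_iff)
  have "P (\<Sum>i\<in>A. Poly_Mapping.single i (Poly_Mapping.lookup f i))" if "finite A" for A
    using that by induction (use assms in auto)
  then show ?thesis using eq by (metis finite_keys)
qed

text \<open>Both sides are additive in each argument, so a nested induction leaves two monomials,
  for which the exponents \<open>s * i\<close> and \<open>s * j\<close> add.\<close>

lemma subst_a_mult: "subst_a s (f * g) = subst_a s f * subst_a s g"
proof (induction f rule: poly_mapping_single_add_induct)
  case (single_add i c f)
  have "subst_a s (Poly_Mapping.single i c * g) = subst_a s (Poly_Mapping.single i c) * subst_a s g"
  proof (induction g rule: poly_mapping_single_add_induct)
    case (single_add j e g)
    have "Poly_Mapping.single (s * i + s * j) (1::rat) =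
        Poly_Mapping.single (s * i) 1 * Poly_Mapping.single (s * j) 1"
      by (simp add: mult_single)
    then show ?case using single_add
      by (simp add: distrib_left subst_a_add mult_single subst_a_single mult_ac)
  qed simp
  with single_add show ?case by (simp add: distrib_right subst_a_add)
qed simp

lemma subst_a_diff: "subst_a s (f - g) = subst_a s f - subst_a s g"
  using subst_a_add[of s "f - g" g] by (simp add: algebra_simps)

lemma subst_a_minus: "subst_a s (- f) = - subst_a s f"
  using subst_a_diff[of s 0 f] by simp

lemma subst_a_sum: "subst_a s (sum f A) = (\<Sum>x\<in>A. subst_a s (f x))"
  by (induction A rule: infinite_finite_induct) (simp_all add: subst_a_add)

lemma subst_a_prod: "subst_a s (prod f A) = (\<Prod>x\<in>A. subst_a s (f x))"
  by (induction A rule: infinite_finite_induct) (simp_all add: subst_a_mult)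

text \<open>The monomial a^i q^j, with integer exponents; it is a unit of the Laurent ring.\<close>

definition monom_aq :: "int \<Rightarrow> int \<Rightarrow> laurent"
  where "monom_aq i j = Poly_Mapping.single i (Poly_Mapping.single j 1)"

lemma monom_aq_mult: "monom_aq i j * monom_aq i' j' = monom_aq (i + i') (j + j')"
  by (simp add: monom_aq_def mult_single)

lemma monom_aq_0 [simp]: "monom_aq 0 0 = 1"
  by (simp add: monom_aq_def)

lemma monom_aq_power: "monom_aq i j ^ k = monom_aq (int k * i) (int k * j)"
  by (induction k) (simp_all add: monom_aq_mult algebra_simps)

lemma subst_a_monom_aq: "subst_a s (monom_aq i j) = Poly_Mapping.single (s * i + j) 1"
  by (simp add: monom_aq_def subst_a_single mult_single add.commute)

text \<open>For exponents \<open>i \<ge> 0\<close> this is the factorisation of a difference of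
  \<open>i\<close>-th powers. A negative exponent reduces to \<open>- i\<close> through the unit
  -a^i q^(s i).\<close>

lemma monom_aq_diff_dvd:
  "(monom_aq 1 0 - monom_aq 0 s) dvd (monom_aq i 0 - monom_aq 0 (s * i))"
proof -
  have nonneg: "(monom_aq 1 0 - monom_aq 0 s) dvd (monom_aq (int k) 0 - monom_aq 0 (s * int k))" for k
    using power_diff_sumr2[of "monom_aq 1 0" k "monom_aq 0 s"]
    by (simp add: monom_aq_power mult.commute)
  show ?thesis
  proof (cases "i \<ge> 0")
    case True
    then show ?thesis using nonneg[of "nat i"] by simp
  next
    case False
    have "monom_aq i 0 - monom_aq 0 (s * i) =
        (monom_aq (- i) 0 - monom_aq 0 (s * (- i))) * (- monom_aq i (s * i))"
      by (simp add: algebra_simps monom_aq_mult)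
    then show ?thesis using nonneg[of "nat (- i)"] False by simp
  qed
qed

text \<open>The remainder theorem for division by a - q^s: by additivity it suffices to treat one
  monomial in \<open>a\<close>. The factor theorem follows from it.\<close>

lemma linear_dvd_diff_subst_a:
  "(monom_aq 1 0 - monom_aq 0 s) dvd (f - Poly_Mapping.single 0 (subst_a s f))"
proof (induction f rule: poly_mapping_single_add_induct)
  case (single_add i c f)
  have "Poly_Mapping.single i c - Poly_Mapping.single 0 (subst_a s (Poly_Mapping.single i c))
      = Poly_Mapping.single 0 c * (monom_aq i 0 - monom_aq 0 (s * i))"
    by (simp add: subst_a_single monom_aq_def algebra_simps mult_single)
  then have "(monom_aq 1 0 - monom_aq 0 s) dvd
      (Poly_Mapping.single i c - Poly_Mapping.single 0 (subst_a s (Poly_Mapping.single i c)))"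
    using monom_aq_diff_dvd by (metis dvd_mult)
  from dvd_add[OF this single_add] show ?case
    by (simp add: subst_a_add Poly_Mapping.single_add algebra_simps)
qed simp

lemma subst_a_eq_0_iff: "subst_a s f = 0 \<longleftrightarrow> (monom_aq 1 0 - monom_aq 0 s) dvd f"
proof
  assume "subst_a s f = 0"
  then show "(monom_aq 1 0 - monom_aq 0 s) dvd f" using linear_dvd_diff_subst_a[of s f] by simp
next
  assume "(monom_aq 1 0 - monom_aq 0 s) dvd f"
  then show "subst_a s f = 0" by (auto simp: subst_a_mult subst_a_diff subst_a_monom_aq elim!: dvdE)
qed

text \<open>Because 1 - a q^n = -q^n (a - q^(-n)), the modulus is a unit times two linear factors in
  \<open>a\<close>.\<close>

lemma modulus_eq:
  "(1 - laurent_a * laurent_q ^ n) * (laurent_a - laurent_q ^ n) =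
    - monom_aq 0 (int n) * (monom_aq 1 0 - monom_aq 0 (- int n)) * (monom_aq 1 0 - monom_aq 0 (int n))"
proof -
  have "laurent_a = monom_aq 1 0" "laurent_q ^ n = monom_aq 0 (int n)"
    using monom_aq_power[of 0 1 n] by (simp_all add: laurent_a_def laurent_q_def monom_aq_def)
  then show ?thesis
    by (simp only:) (simp add: monom_aq_mult algebra_simps)
qed

text \<open>A common divisor \<open>c\<close> is nonzero at both roots, since \<open>D\<close> is.
  Writing the modulus as \<open>c * e\<close>, the factor theorem puts both linear factors into
  \<open>e\<close>; cancelling them leaves \<open>c\<close> as a divisor of the unit -q^n.\<close>

lemma coprime_in_modulus:
  assumes "subst_a (int n) D \<noteq> 0" "subst_a (- int n) D \<noteq> 0"
  shows "coprime_in D ((1 - laurent_a * laurent_q ^ n) * (laurent_a - laurent_q ^ n))"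
  unfolding coprime_in_def
proof (intro allI impI)
  fix c assume cD: "c dvd D"
    and cP: "c dvd ((1 - laurent_a * laurent_q ^ n) * (laurent_a - laurent_q ^ n))"
  let ?p = "\<lambda>s. monom_aq 1 0 - monom_aq 0 s"
  have c: "subst_a (int n) c \<noteq> 0" "subst_a (- int n) c \<noteq> 0"
    using assms cD by (auto simp: subst_a_mult elim!: dvdE)
  have p_nz: "?p s \<noteq> 0" for s
  proof
    assume "?p s = 0"
    then have "Poly_Mapping.lookup (?p s) 1 = 0" by simp
    then show False by (simp add: monom_aq_def lookup_minus lookup_single)
  qed
  have "subst_a s (?p s) = 0" for s by (simp add: subst_a_eq_0_iff)
  obtain e where e: "- monom_aq 0 (int n) * ?p (- int n) * ?p (int n) = c * e"
    using cP unfolding modulus_eq by (elim dvdE)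
  \<comment> \<open>At a = q^n the modulus vanishes but \<open>c\<close> does not, so the cofactor
    must vanish there.\<close>
  from arg_cong[OF e, of "subst_a (int n)"] c have "subst_a (int n) e = 0"
    by (simp add: subst_a_mult subst_a_minus \<open>\<And>s. subst_a s (?p s) = 0\<close>)
  then obtain e' where e': "e = ?p (int n) * e'" by (auto simp: subst_a_eq_0_iff elim!: dvdE)
  have "?p (int n) * (- monom_aq 0 (int n) * ?p (- int n)) = ?p (int n) * (c * e')"
    using e unfolding e' by (simp only: mult_ac)
  then have e2: "- monom_aq 0 (int n) * ?p (- int n) = c * e'"
    using p_nz[of "int n"] by (simp only: mult_cancel_left) simp
  from arg_cong[OF e2, of "subst_a (- int n)"] c have "subst_a (- int n) e' = 0"
    by (simp add: subst_a_mult subst_a_minus \<open>\<And>s. subst_a s (?p s) = 0\<close>)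
  then obtain e'' where e'': "e' = ?p (- int n) * e''" by (auto simp: subst_a_eq_0_iff elim!: dvdE)
  have "?p (- int n) * (- monom_aq 0 (int n)) = ?p (- int n) * (c * e'')"
    using e2 unfolding e'' by (simp only: mult_ac)
  then have "- monom_aq 0 (int n) = c * e''"
    using p_nz[of "- int n"] by (simp only: mult_cancel_left) simp
  then have "1 = c * e'' * (- monom_aq 0 (- int n))"
    by (simp add: monom_aq_mult flip: \<open>- monom_aq 0 (int n) = c * e''\<close>)
  then show "c dvd 1" by (metis dvd_triv_left mult.assoc)
qed

text \<open>As \<open>n > 0\<close>, the roots q^n and q^(-n) differ. After the first linear factor
  is removed, the second root therefore passes to the cofactor, and the factor theorem applies
  again.\<close>

lemma modulus_dvd:
  assumes "n > 0" "subst_a (int n) f = 0" "subst_a (- int n) f = 0"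
  shows "((1 - laurent_a * laurent_q ^ n) * (laurent_a - laurent_q ^ n)) dvd f"
proof -
  let ?p = "\<lambda>s. monom_aq 1 0 - monom_aq 0 s"
  obtain g where g: "f = ?p (int n) * g" using assms(2) by (auto simp: subst_a_eq_0_iff elim!: dvdE)
  have "Poly_Mapping.single (- int n) (1::rat) \<noteq> Poly_Mapping.single (int n) 1"
    using assms(1) by (auto simp: poly_mapping_eq_iff lookup_single fun_eq_iff when_def dest!: spec[of _ "int n"])
  then have "subst_a (- int n) (?p (int n)) \<noteq> 0" by (simp add: subst_a_diff subst_a_monom_aq)
  then have "subst_a (- int n) g = 0" using assms(3) by (simp add: g subst_a_mult)
  then obtain h where h: "g = ?p (- int n) * h" by (auto simp: subst_a_eq_0_iff elim!: dvdE)
  have "f = (- monom_aq 0 (int n) * ?p (- int n) * ?p (int n)) * (- monom_aq 0 (- int n) * h)"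
  proof -
    have "(- monom_aq 0 (int n) * ?p (- int n) * ?p (int n)) * (- monom_aq 0 (- int n) * h) =
        (monom_aq 0 (int n) * monom_aq 0 (- int n)) * (?p (int n) * (?p (- int n) * h))"
      by (simp only: mult_ac minus_mult_minus mult_minus_left mult_minus_right minus_minus)
    then show ?thesis unfolding g h by (simp add: monom_aq_mult)
  qed
  then show ?thesis unfolding modulus_eq by (metis dvd_triv_left)
qed

section \<open>From vanishing after substitution to the congruence\<close>

lemma to_fract_prod: "to_fract (prod f A) = (\<Prod>x\<in>A. to_fract (f x))"
  by (induction A rule: infinite_finite_induct) simp_all

text \<open>Over the common denominator \<open>D\<close>, the product of all \<open>De k\<close>,
  the hypothesis on denominators makes \<open>D\<close> coprime to the modulus. The substituted sum,
  multiplied by the substituted \<open>D\<close>, is the substituted numerator, which is therefore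
  zero at both roots.\<close>

lemma ratfun_cong_0_sumI:
  fixes Nu De :: "'i \<Rightarrow> laurent"
  assumes n: "n > 0" and A: "finite A"
    and De: "\<And>s k. s = int n \<or> s = - int n \<Longrightarrow> k \<in> A \<Longrightarrow> subst_a s (De k) \<noteq> 0"
    and sum: "\<And>s. s = int n \<or> s = - int n \<Longrightarrow>
      (\<Sum>k\<in>A. to_fract (subst_a s (Nu k)) / to_fract (subst_a s (De k))) = 0"
  shows "ratfun_cong_0 (\<Sum>k\<in>A. to_fract (Nu k) / to_fract (De k))
    ((1 - laurent_a * laurent_q ^ n) * (laurent_a - laurent_q ^ n))"
proof -
  define D where "D = prod De A"
  define N where "N = (\<Sum>k\<in>A. Nu k * prod De (A - {k}))"
  have D_nz: "subst_a s D \<noteq> 0" if "s = int n \<or> s = - int n" for s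
    using De[OF that] A by (simp add: D_def subst_a_prod)
  have D0: "D \<noteq> 0" using D_nz[of "int n"] by auto
  have De0: "De k \<noteq> 0" if "k \<in> A" for k using De[of "int n" k] that by auto
  have split: "D = De k * prod De (A - {k})" if "k \<in> A" for k
    using that A by (simp add: D_def prod.remove)
  have "to_fract (Nu k) / to_fract (De k) = to_fract (Nu k * prod De (A - {k})) / to_fract D"
    if "k \<in> A" for k
    using D0 De0[OF that] split[OF that] by (simp add: divide_simps)
  then have "(\<Sum>k\<in>A. to_fract (Nu k) / to_fract (De k)) = to_fract N / to_fract D"
    by (simp add: N_def sum_divide_distrib)
  moreover have "subst_a s N = 0" if s: "s = int n \<or> s = - int n" for s
  proof -
    have "to_fract (subst_a s (Nu k * prod De (A - {k}))) =
        to_fract (subst_a s D) * (to_fract (subst_a s (Nu k)) / to_fract (subst_a s (De k)))"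
      if "k \<in> A" for k
      using De[OF s that] split[OF that] by (simp add: subst_a_mult)
    then have "to_fract (subst_a s N) = to_fract (subst_a s D) *
        (\<Sum>k\<in>A. to_fract (subst_a s (Nu k)) / to_fract (subst_a s (De k)))"
      by (simp add: N_def subst_a_sum sum_distrib_left)
    then show ?thesis using sum[OF s] by simp
  qed
  ultimately show ?thesis
    unfolding ratfun_cong_0_def using D0 D_nz n
    by (intro exI[of _ N] exI[of _ D]) (auto intro: coprime_in_modulus modulus_dvd)
qed

lemma subst_a_qpoch: "subst_a s (qpoch x y k) = qpoch (subst_a s x) (subst_a s y) k"
proof -
  have "subst_a s (y ^ i) = subst_a s y ^ i" for i by (induction i) (simp_all add: subst_a_mult)
  then show ?thesis by (simp add: qpoch_def subst_a_prod subst_a_diff subst_a_mult)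
qed

lemma to_fract_power: "to_fract (x ^ k) = to_fract x ^ k"
  by (induction k) simp_all

lemma to_fract_qpoch: "to_fract (qpoch x y k) = qpoch (to_fract x) (to_fract y) k"
  by (simp add: qpoch_def to_fract_prod to_fract_power)

text \<open>Nonnegative exponents follow by induction, negative ones because \<open>u i\<close> and
  \<open>u (- i)\<close> are inverse. It identifies images of monomials with integer powers of the
  variables.\<close>

lemma powi_unique:
  fixes u :: "int \<Rightarrow> 'a::field"
  assumes "u 0 = 1" "\<And>i j. u (i + j) = u i * u j"
  shows "u 1 powi i = u i"
proof -
  have nat: "u 1 ^ k = u (int k)" for k
    by (induction k) (simp_all add: assms(1) assms(2)[symmetric])
  show ?thesis
  proof (cases "i \<ge> 0")
    case True
    then show ?thesis by (simp add: power_int_def nat)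
  next
    case False
    then have "u i * u (- i) = 1" by (simp add: assms(1) assms(2)[symmetric])
    with False show ?thesis by (simp add: power_int_def nat power_inverse inverse_unique mult.commute)
  qed
qed

lemma to_fract_monom_aq: "to_fract (monom_aq i j) = var_a powi i * var_q powi j"
proof -
  have "var_a powi i = to_fract (monom_aq i 0)"
    using powi_unique[of "\<lambda>i. to_fract (monom_aq i 0)" i]
    by (simp add: monom_aq_mult flip: to_fract_mult)
       (simp add: var_a_def laurent_a_def monom_aq_def)
  moreover have "var_q powi j = to_fract (monom_aq 0 j)"
    using powi_unique[of "\<lambda>i. to_fract (monom_aq 0 i)" j]
    by (simp add: monom_aq_mult flip: to_fract_mult)
       (simp add: var_q_def laurent_q_def monom_aq_def)
  ultimately show ?thesis by (simp add: monom_aq_mult flip: to_fract_mult)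
qed

text \<open>The variable \<open>q\<close> in the fraction field of the one-variable Laurent ring. It
  plays the part of \<open>x\<close> in the vanishing identities; no nonzero power of it is
  1.\<close>

definition fract_q :: "(int \<Rightarrow>\<^sub>0 rat) fract"
  where "fract_q = to_fract (Poly_Mapping.single 1 1)"

lemma to_fract_single: "to_fract (Poly_Mapping.single j 1) = fract_q powi j"
  using powi_unique[of "\<lambda>j. to_fract (Poly_Mapping.single j (1::rat))" j]
  by (simp add: fract_q_def mult_single flip: to_fract_mult)

lemma fract_q_powi_neq_1: "i \<noteq> 0 \<Longrightarrow> fract_q powi i \<noteq> 1"
  unfolding to_fract_single[symmetric] to_fract_1[symmetric] to_fract_eq_iff
  by (auto simp: poly_mapping_eq_iff lookup_single lookup_one fun_eq_iff when_def dest!: spec[of _ 0])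

lemma fract_q_neq_0: "fract_q \<noteq> 0"
  using to_fract_single[of 1] by (auto simp: poly_mapping_eq_iff lookup_single fun_eq_iff fract_q_def when_def dest!: spec[of _ 1])

theorem theorem2p1:
  fixes d n :: nat and r :: int
  assumes "d \<ge> 2"
    and "r \<le> int d - 2"
    and "gcd r (int d) = 1"
    and "n > 0"
    and "[int n = - r] (mod int d)"
    and "int n \<ge> int d - r"
  shows "(odd d \<longrightarrow>
      ratfun_cong_0
        (\<Sum>k = 0..n - 1.
          (qpoch (var_q powi r) (var_q ^ d) k * var_q ^ (d * k) *
            (\<Prod>j = 1..(d - 1) div 2.
              qpoch (var_a powi (2 * int j) * var_q powi r) (var_q ^ d) k *
              qpoch (var_a powi (- 2 * int j) * var_q powi r) (var_q ^ d) k)) /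
          (qpoch (var_q ^ d) (var_q ^ d) k *
            (\<Prod>j = 1..(d - 1) div 2.
              qpoch (var_a powi (2 * int j - 1) * var_q ^ d) (var_q ^ d) k *
              qpoch (var_a powi (1 - 2 * int j) * var_q ^ d) (var_q ^ d) k)))
        ((1 - laurent_a * laurent_q ^ n) * (laurent_a - laurent_q ^ n))) \<and>
    (even d \<longrightarrow>
      ratfun_cong_0
        (\<Sum>k = 0..n - 1.
          (var_q ^ (d * k) *
            (\<Prod>j = 1..d div 2.
              qpoch (var_a powi (2 * int j - 1) * var_q powi r) (var_q ^ d) k *
              qpoch (var_a powi (1 - 2 * int j) * var_q powi r) (var_q ^ d) k)) /
          (\<Prod>j = 0..d div 2 - 1.
            qpoch (var_a powi (2 * int j) * var_q ^ d) (var_q ^ d) k *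
            qpoch (var_a powi (- 2 * int j) * var_q ^ d) (var_q ^ d) k))
        ((1 - laurent_a * laurent_q ^ n) * (laurent_a - laurent_q ^ n)))"
proof -
  let ?M = monom_aq
  have d: "d > 0" using assms(1) by simp
  have "gcd (int n) (int d) = gcd (- r) (int d)" by (rule cong_gcd_eq[OF assms(5)])
  then have nd: "coprime (int n) (int d)" using assms(3) by (simp add: coprime_iff_gcd_eq_1)
  note q = fract_q_neq_0 fract_q_powi_neq_1
  \<comment> \<open>Here \<open>c\<close> is the exponent of \<open>a\<close> in a denominator
    parameter; \<open>c = 0\<close> gives the factor (q^d; q^d)_k.\<close>
  have nz: "qpoch (fract_q powi (s * c + int d)) (fract_q ^ d) k \<noteq> 0"
    if "s = int n \<or> s = - int n" "\<bar>c\<bar> < int d" for s c k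
    using qpoch_denominator_neq_0[OF q d nd that(2,1)] .
  note subst = subst_a_mult subst_a_prod subst_a_qpoch subst_a_monom_aq to_fract_prod to_fract_qpoch
    to_fract_single
  \<comment> \<open>These rules turn the Laurent polynomials below back into expressions in
    \<open>var_a\<close> and \<open>var_q\<close>, whereas \<open>subst\<close> evaluates them as
    powers of \<open>fract_q\<close>.\<close>
  note lift = to_fract_prod to_fract_qpoch to_fract_monom_aq
  \<comment> \<open>Numerators and denominators are written with Laurent monomials, so negative
    exponents of \<open>a\<close> and a negative \<open>r\<close> need no clearing before
    \<open>ratfun_cong_0_sumI\<close> applies.\<close>
  have odd: "ratfun_cong_0
        (\<Sum>k = 0..n - 1.
          to_fract (qpoch (?M 0 r) (?M 0 (int d)) k * ?M 0 (int (d * k)) *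
            (\<Prod>j = 1..(d - 1) div 2.
              qpoch (?M (2 * int j) r) (?M 0 (int d)) k *
              qpoch (?M (- 2 * int j) r) (?M 0 (int d)) k)) /
          to_fract (qpoch (?M 0 (int d)) (?M 0 (int d)) k *
            (\<Prod>j = 1..(d - 1) div 2.
              qpoch (?M (2 * int j - 1) (int d)) (?M 0 (int d)) k *
              qpoch (?M (1 - 2 * int j) (int d)) (?M 0 (int d)) k)))
        ((1 - laurent_a * laurent_q ^ n) * (laurent_a - laurent_q ^ n))" if "odd d"
  proof (rule ratfun_cong_0_sumI[OF assms(4)])
    fix s :: int and k assume s: "s = int n \<or> s = - int n"
    have "to_fract (subst_a s (qpoch (?M 0 (int d)) (?M 0 (int d)) k *
            (\<Prod>j = 1..(d - 1) div 2.
              qpoch (?M (2 * int j - 1) (int d)) (?M 0 (int d)) k *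
              qpoch (?M (1 - 2 * int j) (int d)) (?M 0 (int d)) k))) \<noteq> 0"
      using nz[OF s, of 0 k] nz[OF s, of "2 * int j - 1" k for j] nz[OF s, of "1 - 2 * int j" k for j] d
      by (auto simp: subst)
    then show "subst_a s (qpoch (?M 0 (int d)) (?M 0 (int d)) k *
            (\<Prod>j = 1..(d - 1) div 2.
              qpoch (?M (2 * int j - 1) (int d)) (?M 0 (int d)) k *
              qpoch (?M (1 - 2 * int j) (int d)) (?M 0 (int d)) k)) \<noteq> 0"
      by simp
  next
    fix s :: int assume s: "s = int n \<or> s = - int n"
    from odd_sum_eq_0[OF q assms(1,2) that assms(5,6) nd s]
    show "(\<Sum>k = 0..n - 1.
          to_fract (subst_a s (qpoch (?M 0 r) (?M 0 (int d)) k * ?M 0 (int (d * k)) *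
            (\<Prod>j = 1..(d - 1) div 2.
              qpoch (?M (2 * int j) r) (?M 0 (int d)) k *
              qpoch (?M (- 2 * int j) r) (?M 0 (int d)) k))) /
          to_fract (subst_a s (qpoch (?M 0 (int d)) (?M 0 (int d)) k *
            (\<Prod>j = 1..(d - 1) div 2.
              qpoch (?M (2 * int j - 1) (int d)) (?M 0 (int d)) k *
              qpoch (?M (1 - 2 * int j) (int d)) (?M 0 (int d)) k)))) = 0"
      by (simp add: subst power_int_of_nat del: of_nat_mult)
  qed simp
  have even: "ratfun_cong_0
        (\<Sum>k = 0..n - 1.
          to_fract (?M 0 (int (d * k)) *
            (\<Prod>j = 1..d div 2.
              qpoch (?M (2 * int j - 1) r) (?M 0 (int d)) k *
              qpoch (?M (1 - 2 * int j) r) (?M 0 (int d)) k)) /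
          to_fract (\<Prod>j = 0..d div 2 - 1.
              qpoch (?M (2 * int j) (int d)) (?M 0 (int d)) k *
              qpoch (?M (- 2 * int j) (int d)) (?M 0 (int d)) k))
        ((1 - laurent_a * laurent_q ^ n) * (laurent_a - laurent_q ^ n))" if "even d"
  proof (rule ratfun_cong_0_sumI[OF assms(4)])
    fix s :: int and k assume s: "s = int n \<or> s = - int n"
    \<comment> \<open>The last index \<open>d div 2 - 1\<close> keeps \<open>2 * j\<close> at most
      \<open>d - 2\<close>.\<close>
    have "\<bar>2 * int j\<bar> < int d" if "j \<in> {0..d div 2 - 1}" for j
      using that d \<open>even d\<close> by (auto elim!: evenE)
    then have "to_fract (subst_a s (\<Prod>j = 0..d div 2 - 1.
              qpoch (?M (2 * int j) (int d)) (?M 0 (int d)) k *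
              qpoch (?M (- 2 * int j) (int d)) (?M 0 (int d)) k)) \<noteq> 0"
      using nz[OF s, of "2 * int j" k for j] nz[OF s, of "- 2 * int j" k for j]
      by (auto simp: subst)
    then show "subst_a s (\<Prod>j = 0..d div 2 - 1.
              qpoch (?M (2 * int j) (int d)) (?M 0 (int d)) k *
              qpoch (?M (- 2 * int j) (int d)) (?M 0 (int d)) k) \<noteq> 0"
      by simp
  next
    fix s :: int assume s: "s = int n \<or> s = - int n"
    from even_sum_eq_0[OF q assms(1,2) that assms(5,6) nd s]
    show "(\<Sum>k = 0..n - 1.
          to_fract (subst_a s (?M 0 (int (d * k)) *
            (\<Prod>j = 1..d div 2.
              qpoch (?M (2 * int j - 1) r) (?M 0 (int d)) k *
              qpoch (?M (1 - 2 * int j) r) (?M 0 (int d)) k))) /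
          to_fract (subst_a s (\<Prod>j = 0..d div 2 - 1.
              qpoch (?M (2 * int j) (int d)) (?M 0 (int d)) k *
              qpoch (?M (- 2 * int j) (int d)) (?M 0 (int d)) k))) = 0"
      by (simp add: subst power_int_of_nat del: of_nat_mult)
  qed simp
  show ?thesis
    using odd even by (simp add: lift power_int_of_nat del: of_nat_mult)
qed

end
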